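(* Every (square, complex) rank one matrix $A$ satisfies Crouzeix's conjecture, i.e. $\|p(A)\|\le 2\sup_{z\in W(A)}|p(z)|$ for every complex polynomial $p$.
   Context: $W(A)=\{\langle Ax,x\rangle:\langle x,x\rangle=1\}$ is the numerical range with respect to the Euclidean inner product on $\mathbb{C}^n$, and $\|\cdot\|$ is the operator norm induced by the Euclidean norm. *)

theory Defs
  imports "HOL-Analysis.Analysis" "HOL-Computational_Algebra.Polynomial"
begin

text \<open>
  The class operation \<open>\<bullet>\<close> on \<open>complex ^ 'n\<close> is the real inner product, that is, the real part of the
  Hermitian one, which is therefore defined here (linear in the first argument). The norm on
  \<open>complex ^ 'n\<close> is the Euclidean norm, so \<open>onorm ((*v) A)\<close> is the operator norm of \<open>A\<close>.
\<close>

definition cinner :: "complex ^ 'n \<Rightarrow> complex ^ 'n \<Rightarrow> complex"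
  where "cinner x y = (\<Sum>i\<in>UNIV. x $ i * cnj (y $ i))"

definition numerical_range :: "complex ^ 'n ^ 'n \<Rightarrow> complex set"
  where "numerical_range A = {cinner (A *v x) x | x. cinner x x = 1}"

text \<open>
  The class operations \<open>*\<close>, \<open>1\<close> and \<open>^\<close> act entrywise on the type \<open>complex ^ 'n ^ 'n\<close>; powers with
  respect to the matrix product are introduced separately.
\<close>

primrec matrix_power :: "complex ^ 'n ^ 'n \<Rightarrow> nat \<Rightarrow> complex ^ 'n ^ 'n"
  where
    "matrix_power A 0 = mat 1"
  | "matrix_power A (Suc k) = A ** matrix_power A k"

definition poly_matrix :: "complex poly \<Rightarrow> complex ^ 'n ^ 'n \<Rightarrow> complex ^ 'n ^ 'n"
  where "poly_matrix p A =
    (\<Sum>k\<le>degree p. (\<chi> i j. coeff p k * matrix_power A k $ i $ j))"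

lemma cinner_self: "cinner x x = of_real ((norm x)\<^sup>2)"
  by (simp add: cinner_def norm_vec_def L2_set_def sum_nonneg flip: complex_norm_square)

lemma numerical_range_eq_image: "numerical_range A = (\<lambda>x. cinner (A *v x) x) ` sphere 0 1"
proof -
  have "cinner x x = 1 \<longleftrightarrow> norm x = 1" for x :: "complex ^ 'a"
    unfolding cinner_self of_real_eq_1_iff by (simp add: power2_eq_1_iff) (smt (verit) norm_ge_zero)
  then show ?thesis
    by (auto simp: numerical_range_def)
qed

text \<open>
  The numerical range is compact and nonempty, so the real-valued supremum of \<open>\<bar>p\<bar>\<close> over it is a
  genuine least upper bound.
\<close>

lemma compact_numerical_range: "compact (numerical_range A)"
  unfolding numerical_range_eq_image cinner_def matrix_vector_mult_def
  by (intro compact_continuous_image continuous_intros) auto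

lemma numerical_range_nonempty: "numerical_range A \<noteq> {}"
proof -
  have "axis undefined 1 \<in> sphere (0 :: complex ^ 'a) 1"
    by simp
  then show ?thesis
    unfolding numerical_range_eq_image by blast
qed

lemma bdd_above_poly_numerical_range: "bdd_above ((\<lambda>z. cmod (poly p z)) ` numerical_range A)"
  by (intro bounded_imp_bdd_above compact_imp_bounded compact_continuous_image
      compact_numerical_range continuous_intros)

end

theory Submission
  imports Defs "HOL-Complex_Analysis.Complex_Analysis"
begin

text \<open>
  In suitable orthonormal coordinates \<open>A\<close> is the block \<open>[[l, b], [0, 0]]\<close> extended by zero, and
  \<open>W(A)\<close> is the elliptic disc with foci \<open>0, l\<close> and minor axis \<open>b\<close>, an affine image of the unit
  sphere of \<open>\<real> \<times> \<complex>\<close>. The matrix \<open>p(A)\<close> is governed by the block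
  \<open>[[p(l), b q], [0, p(0)]]\<close> with \<open>q\<close> the divided difference of \<open>p\<close> at \<open>l, 0\<close>; by the determinant
  criterion its norm is at most 2 when \<open>\<bar>p\<bar> < 1\<close> on \<open>W(A)\<close> and
  \<open>4 b\<^sup>2 \<bar>q\<bar>\<^sup>2 \<le> (4 - \<bar>p(l)\<bar>\<^sup>2) (4 - \<bar>p(0)\<bar>\<^sup>2)\<close>.

  Only an upper bound for \<open>\<bar>q\<bar>\<close> is needed, so the Riemann map of the ellipse can be replaced by any
  good enough holomorphic map \<open>\<phi>\<close> of the disc into it. Let \<open>s\<close> be half the sum of the major and minor axes,
  \<open>a = \<bar>l\<bar> / s\<close> and \<open>t = a\<^sup>2 / 4\<close>. If \<open>a < 1\<close>, the map
  \<open>\<phi> z = (sgn l) (s / 2) (a + (1 - 4 t\<^sup>2) z / (1 - t z\<^sup>2))\<close> sends the unit circle into the ellipse and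
  \<open>-a, a\<close> to the foci \<open>0, l\<close>, and Schwarz-Pick for \<open>p \<circ> \<phi>\<close> at \<open>\<plusminus>a\<close> gives the required bound. If
  \<open>a \<ge> 1\<close>, the trivial estimate \<open>\<bar>p(l) - p(0)\<bar> \<le> 2\<close> suffices. Stating Schwarz-Pick with a divided
  difference covers the nilpotent case \<open>l = 0\<close> as well.
\<close>

section \<open>Schwarz-Pick inequality\<close>

text \<open>For \<open>x\<close> and \<open>y\<close> in the closed unit disc this gives
  \<open>cmod (y - x) \<le> cmod (1 - cnj x * y)\<close>, with equality as soon as one of them has
  modulus 1.\<close>

lemma norm_one_minus_cnj_mult_sq:
  fixes x y :: complex
  shows "(cmod (1 - cnj x * y))\<^sup>2 = (cmod (y - x))\<^sup>2 + (1 - (cmod x)\<^sup>2) * (1 - (cmod y)\<^sup>2)"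
  unfolding cmod_power2 by (simp add: algebra_simps power2_eq_square)

text \<open>The maximum modulus principle is applied to \<open>g\<close>, which on the unit circle
  has the modulus of \<open>(h z - w) / (1 - cnj w * h z)\<close>. Using the cofactor
  \<open>k\<close> instead of a quotient allows \<open>z1 = z0\<close>, where the inequality bounds
  a derivative.\<close>

lemma schwarz_pick_divided_difference:
  assumes h: "h holomorphic_on ball 0 1" "continuous_on (cball 0 1) h"
    and k: "k holomorphic_on ball 0 1" "continuous_on (cball 0 1) k"
    and hk: "\<And>z. norm z \<le> 1 \<Longrightarrow> h z = w + (z - z0) * k z"
    and bound: "\<And>z. norm z = 1 \<Longrightarrow> cmod (h z) \<le> 1"
    and w: "cmod w < 1" and z0: "cmod z0 < 1" and z1: "cmod z1 < 1"
  shows "cmod (k z1) * cmod (1 - cnj z0 * z1) \<le> cmod (1 - cnj w * h z1)"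
proof -
  have h_le: "cmod (h z) \<le> 1" if "norm z \<le> 1" for z
    by (rule maximum_modulus_frontier[of h "cball 0 1"]) (use h bound that in auto)
  have nz: "1 - cnj w * h z \<noteq> 0" if "norm z \<le> 1" for z
  proof
    assume "1 - cnj w * h z = 0"
    then have "1 = cmod w * cmod (h z)"
      by (metis complex_mod_cnj eq_iff_diff_eq_0 norm_mult norm_one)
    moreover have "cmod w * cmod (h z) \<le> cmod w * 1"
      by (rule mult_left_mono) (use h_le[OF that] in auto)
    ultimately show False using w by simp
  qed
  define g where "g = (\<lambda>z. k z * (1 - cnj z0 * z) / (1 - cnj w * h z))"
  have "cmod (g z1) \<le> 1"
  proof (rule maximum_modulus_frontier[of g "cball 0 1"])
    show "g holomorphic_on interior (cball 0 1)"
      unfolding g_def using nz by (auto intro!: holomorphic_intros h k)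
    show "continuous_on (closure (cball 0 1)) g"
      unfolding g_def using nz by (auto intro!: continuous_intros h k)
    fix z :: complex assume "z \<in> frontier (cball 0 1)"
    then have z: "norm z = 1" by simp
    have "(cmod (1 - cnj z0 * z))\<^sup>2 = (cmod (z - z0))\<^sup>2"
      unfolding norm_one_minus_cnj_mult_sq z by simp
    then have eq: "cmod (1 - cnj z0 * z) = cmod (z - z0)" by simp
    have "(cmod (h z - w))\<^sup>2 \<le> (cmod (1 - cnj w * h z))\<^sup>2"
      unfolding norm_one_minus_cnj_mult_sq using w bound[OF z]
      by (simp add: power_le_one)
    then have "cmod (h z - w) \<le> cmod (1 - cnj w * h z)"
      by (rule power2_le_imp_le) simp
    moreover have "cmod (k z) * cmod (1 - cnj z0 * z) = cmod (h z - w)"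
      using hk[of z] z eq by (simp add: norm_mult)
    ultimately show "cmod (g z) \<le> 1"
      unfolding g_def using nz[of z] z by (simp add: norm_mult norm_divide)
  qed (use z1 in auto)
  then show ?thesis
    using nz[of z1] z1 by (simp add: g_def norm_mult norm_divide)
qed

section \<open>Elliptic discs\<close>

text \<open>\<open>P\<close> forces \<open>Im Y\<close> and the component of
  \<open>(X, Re Y)\<close> along \<open>(a, b)\<close>. A multiple \<open>\<tau>\<close> of the
  orthogonal vector \<open>(-b, a)\<close> then completes \<open>(X, Y)\<close> to norm one.\<close>

lemma ellipse_eq_projected_sphere:
  fixes a b :: real and P :: complex
  assumes b: "b > 0" and P: "(Re P)\<^sup>2 / (a\<^sup>2 + b\<^sup>2) + (Im P)\<^sup>2 / b\<^sup>2 \<le> 1"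
  obtains X :: real and Y :: complex where "X\<^sup>2 + (cmod Y)\<^sup>2 = 1" "P = of_real (a * X) + of_real b * Y"
proof -
  define m where "m = a\<^sup>2 + b\<^sup>2"
  have m: "m > 0" using b by (simp add: m_def add_nonneg_pos)
  define r where "r = 1 - (Im P)\<^sup>2 / b\<^sup>2 - (Re P)\<^sup>2 / m"
  have r: "r \<ge> 0" using P by (simp add: r_def m_def)
  define \<tau> where "\<tau> = sqrt (r / m)"
  have \<tau>: "\<tau>\<^sup>2 = r / m" using r m by (simp add: \<tau>_def)
  define \<rho> where "\<rho> = Re P / m"
  define X where "X = \<rho> * a - \<tau> * b"
  define Y1 where "Y1 = \<rho> * b + \<tau> * a"
  have "X\<^sup>2 + Y1\<^sup>2 = (\<rho>\<^sup>2 + \<tau>\<^sup>2) * m"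
    by (simp add: X_def Y1_def m_def power2_eq_square algebra_simps)
  also have "\<dots> = (Re P)\<^sup>2 / m + r"
    unfolding \<tau> using m by (simp add: \<rho>_def power2_eq_square field_simps)
  finally have "X\<^sup>2 + Y1\<^sup>2 + (Im P / b)\<^sup>2 = 1"
    by (simp add: r_def power_divide)
  moreover have "a * X + b * Y1 = \<rho> * m"
    by (simp add: X_def Y1_def m_def algebra_simps power2_eq_square)
  then have "a * X + b * Y1 = Re P" using m by (simp add: \<rho>_def)
  ultimately show ?thesis
    using b that[of X "Complex Y1 (Im P / b)"] by (simp add: cmod_power2 complex_eq_iff)
qed

text \<open>The left side turns out to be a concave quadratic in \<open>1 / D\<close>, with maximum
  \<open>(\<mu> * (A + B) / (2 * (A * B)))\<^sup>2\<close>; the factor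
  \<open>1 - 4 * t\<^sup>2\<close> is small enough to keep this below 1.\<close>

lemma inverted_ellipse_in_ellipse:
  fixes t :: real and z :: complex
  assumes t: "0 \<le> t" "4 * t < 1" and z: "norm z = 1"
  defines "P \<equiv> of_real (1 - 4 * t\<^sup>2) * z / (1 - of_real t * z\<^sup>2)"
  shows "(Re P)\<^sup>2 / (1 + t)\<^sup>2 + (Im P)\<^sup>2 / (1 - t)\<^sup>2 \<le> 1"
proof -
  define c s where "c = Re z" and "s = Im z"
  have cs: "c\<^sup>2 + s\<^sup>2 = 1" using z by (simp add: c_def s_def cmod_def)
  have zc: "z * cnj z = 1" using z complex_norm_square[of z] by simp
  define \<mu> where "\<mu> = 1 - 4 * t\<^sup>2"
  \<comment> \<open>As \<open>\<bar>z\<bar> = 1\<close>, the denominator is \<open>z\<close> times the point \<open>cnj z - t z\<close> of an ellipse, with squared modulus \<open>D\<close>.\<close>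
  define A B where "A = (1 - t)\<^sup>2" and "B = (1 + t)\<^sup>2"
  have A: "A > 0" and B: "B > 0" using t by (auto simp: A_def B_def)
  define D where "D = A * c\<^sup>2 + B * s\<^sup>2"
  have "D = A + 4 * t * s\<^sup>2"
    using cs by (simp add: D_def A_def B_def power2_eq_square) algebra
  then have D: "D > 0" using A t(1) by (simp add: add_pos_nonneg)
  have nz: "1 - of_real t * z\<^sup>2 \<noteq> 0"
  proof
    assume "1 - of_real t * z\<^sup>2 = 0"
    then have "1 = cmod (of_real t * z\<^sup>2)" by (metis eq_iff_diff_eq_0 norm_one)
    then show False using t z by (simp add: norm_mult norm_power)
  qed
  define N where "N = Complex ((1 - t) * c) ((1 + t) * s)"
  have N: "N = z - of_real t * cnj z" by (simp add: N_def c_def s_def complex_eq_iff algebra_simps)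
  have "of_real D = N * (cnj z - of_real t * z)"
    by (simp add: N_def D_def A_def B_def complex_eq_iff c_def s_def power2_eq_square algebra_simps)
  then have "of_real D * z = N * (1 - of_real t * z\<^sup>2)"
    using zc by algebra
  then have "z / (1 - of_real t * z\<^sup>2) = N / of_real D"
    using nz D by (simp add: frac_eq_eq mult.commute)
  then have "P = of_real (\<mu> / D) * N"
    unfolding P_def \<mu>_def[symmetric] times_divide_eq_right[symmetric] by simp
  then have P: "Re P = \<mu> / D * ((1 - t) * c)" "Im P = \<mu> / D * ((1 + t) * s)"
    by (auto simp: N_def)
  \<comment> \<open>\<open>A\<close> and \<open>B\<close> are the roots of
    \<open>x\<^sup>2 = (A + B) * x - A * B\<close>; this averages the equation over them with
    weights \<open>c\<^sup>2\<close> and \<open>s\<^sup>2\<close>.\<close>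
  have num: "A\<^sup>2 * c\<^sup>2 + B\<^sup>2 * s\<^sup>2 = (A + B) * D - A * B"
    unfolding D_def using cs by algebra
  have "(Re P)\<^sup>2 / B + (Im P)\<^sup>2 / A = (\<mu> / D)\<^sup>2 * (A * c\<^sup>2 / B + B * s\<^sup>2 / A)"
    unfolding P power_mult_distrib A_def[symmetric] B_def[symmetric] by (simp add: algebra_simps)
  also have "A * c\<^sup>2 / B + B * s\<^sup>2 / A = ((A + B) * D - A * B) / (A * B)"
    unfolding num[symmetric] using A B by (simp add: field_simps power2_eq_square)
  also have "(\<mu> / D)\<^sup>2 * (((A + B) * D - A * B) / (A * B)) \<le> 1"
  proof -
    have "(A + B) * D - A * B \<le> ((A + B) * D)\<^sup>2 / (4 * (A * B))"
      using A B zero_le_power2[of "(A + B) * D - 2 * (A * B)"]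
      by (simp add: field_simps power2_eq_square)
    then have "(\<mu> / D)\<^sup>2 * (((A + B) * D - A * B) / (A * B))
        \<le> (\<mu> / D)\<^sup>2 * (((A + B) * D)\<^sup>2 / (4 * (A * B)) / (A * B))"
      using A B by (intro mult_left_mono divide_right_mono) auto
    also have "\<dots> = (\<mu> * (A + B) / (2 * (A * B)))\<^sup>2"
      using D by (simp add: power_mult_distrib power_divide) (simp add: power2_eq_square)
    also have "\<dots> \<le> 1"
    proof -
      have "\<mu> * (A + B) \<le> 2 * (A * B)"
      proof -
        have "2 * (A * B) - \<mu> * (A + B) = 2 * t\<^sup>2 + 10 * t ^ 4"
          unfolding A_def B_def \<mu>_def by algebra
        then have "2 * (A * B) - \<mu> * (A + B) \<ge> 0" by simp
        then show ?thesis by linarith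
      qed
      moreover have "\<mu> \<ge> 0" using power_mono[of t "1/4" 2] t by (simp add: \<mu>_def power2_eq_square)
      ultimately have "\<mu> * (A + B) / (2 * (A * B)) \<le> 1" "\<mu> * (A + B) / (2 * (A * B)) \<ge> 0"
        using A B by auto
      then show ?thesis by (simp add: power_le_one)
    qed
    finally show ?thesis .
  qed
  finally show ?thesis by (simp add: A_def B_def)
qed

section \<open>The two by two block\<close>

lemma two_by_two_norm_bound:
  fixes \<alpha> \<beta> \<gamma> x y :: complex
  assumes "cmod \<alpha> \<le> 1" "cmod \<gamma> \<le> 1"
    and det: "4 * (cmod \<beta>)\<^sup>2 \<le> (4 - (cmod \<alpha>)\<^sup>2) * (4 - (cmod \<gamma>)\<^sup>2)"
  shows "(cmod (\<alpha> * x + \<beta> * y))\<^sup>2 + (cmod (\<gamma> * y))\<^sup>2 \<le> 4 * ((cmod x)\<^sup>2 + (cmod y)\<^sup>2)"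
proof -
  define a b g X Y where "a = cmod \<alpha>" and "b = cmod \<beta>" and "g = cmod \<gamma>" and "X = cmod x" and "Y = cmod y"
  have a: "a\<^sup>2 \<le> 1" "g\<^sup>2 \<le> 1" using assms by (auto simp: a_def g_def power_le_one)
  have "(cmod (\<alpha> * x + \<beta> * y)) \<le> a * X + b * Y"
    unfolding a_def b_def X_def Y_def by (metis norm_mult norm_triangle_ineq)
  then have le: "(cmod (\<alpha> * x + \<beta> * y))\<^sup>2 \<le> (a * X + b * Y)\<^sup>2" by (simp add: power_mono)
  \<comment> \<open>Completing the square in \<open>X\<close>: the coefficient left at
    \<open>Y\<^sup>2\<close> is the determinant of the quadratic form, which \<open>det\<close>
    makes nonnegative.\<close>
  have "(4 - a\<^sup>2) * (4 * X\<^sup>2 + 4 * Y\<^sup>2 - (a * X + b * Y)\<^sup>2 - g\<^sup>2 * Y\<^sup>2)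
     = ((4 - a\<^sup>2) * X - a * b * Y)\<^sup>2 + ((4 - a\<^sup>2) * (4 - g\<^sup>2) - 4 * b\<^sup>2) * Y\<^sup>2"
    by (simp add: power2_eq_square algebra_simps)
  moreover have "\<dots> \<ge> 0" using det by (simp add: a_def b_def g_def)
  ultimately have "(4 - a\<^sup>2) * (4 * X\<^sup>2 + 4 * Y\<^sup>2 - (a * X + b * Y)\<^sup>2 - g\<^sup>2 * Y\<^sup>2) \<ge> 0"
    by simp
  then have "4 * X\<^sup>2 + 4 * Y\<^sup>2 - (a * X + b * Y)\<^sup>2 - g\<^sup>2 * Y\<^sup>2 \<ge> 0"
    using a(1) by (simp only: zero_le_mult_iff) linarith
  then have "(a * X + b * Y)\<^sup>2 + g\<^sup>2 * Y\<^sup>2 \<le> 4 * X\<^sup>2 + 4 * Y\<^sup>2" by linarith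
  with le show ?thesis
    by (simp add: norm_mult power_mult_distrib g_def X_def Y_def)
qed


text \<open>Here \<open>u\<close> and \<open>v\<close> stand for the moduli of \<open>p\<close> at
  the two foci and \<open>Q\<close> for the scaled divided difference. The hypotheses
  \<open>d\<close> and \<open>pick\<close> together force \<open>Q \<le> 2\<close>, and AM-GM gives
  \<open>(3 + r)\<^sup>2 \<le> (4 - u\<^sup>2) * (4 - v\<^sup>2)\<close>.\<close>

lemma crouzeix_scalar_estimate:
  fixes a Q u v :: real
  assumes a: "0 \<le> a" "a < 1" and Q: "Q \<ge> 0" and u: "u\<^sup>2 \<le> 1" and v: "v\<^sup>2 \<le> 1"
    and d: "(Q * a)\<^sup>2 \<le> 2 * (u\<^sup>2 + v\<^sup>2)"
    and pick: "(Q * (1 - a\<^sup>2) / 2)\<^sup>2 \<le> (1 - u\<^sup>2) * (1 - v\<^sup>2)"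
  shows "(2 * Q * (1 - a\<^sup>2 / 4))\<^sup>2 \<le> (4 - u\<^sup>2) * (4 - v\<^sup>2)"
proof -
  define r where "r = sqrt ((1 - u\<^sup>2) * (1 - v\<^sup>2))"
  have r2: "r\<^sup>2 = (1 - u\<^sup>2) * (1 - v\<^sup>2)" using u v by (simp add: r_def)
  have r0: "r \<ge> 0" using u v by (simp add: r_def)
  have a2: "a\<^sup>2 \<le> 1" using a by (simp add: power_le_one)
  have Qr: "Q * (1 - a\<^sup>2) / 2 \<le> r"
    by (rule power2_le_imp_le[OF _ r0]) (use pick in \<open>simp add: r2\<close>)
  have "0 \<le> (u\<^sup>2 - v\<^sup>2)\<^sup>2" by simp
  also have "\<dots> = (2 - u\<^sup>2 - v\<^sup>2)\<^sup>2 - (2 * r)\<^sup>2"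
    unfolding power_mult_distrib r2 by (simp add: power2_eq_square algebra_simps)
  finally have "(2 * r)\<^sup>2 \<le> (2 - u\<^sup>2 - v\<^sup>2)\<^sup>2" by linarith
  then have rs: "2 * r \<le> 2 - u\<^sup>2 - v\<^sup>2"
    by (rule power2_le_imp_le) (use u v in linarith)
  \<comment> \<open>A quarter of \<open>d\<close> plus \<open>Qr\<close> and half of
    \<open>rs\<close> is a quadratic inequality in \<open>Q\<close> with root 2.\<close>
  have "(Q - 2) * (Q * a\<^sup>2 / 4 + 1 / 2) = (Q * a)\<^sup>2 / 4 + Q * (1 - a\<^sup>2) / 2 - 1"
    by (simp add: power2_eq_square algebra_simps add_divide_distrib diff_divide_distrib)
  also have "\<dots> \<le> 0" using Qr rs d by simp
  finally have "(Q - 2) * (Q * a\<^sup>2 / 4 + 1 / 2) \<le> 0" .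
  moreover have "Q * a\<^sup>2 / 4 + 1 / 2 > 0" using Q by (simp add: add_nonneg_pos)
  ultimately have "Q \<le> 2" by (auto simp: mult_le_0_iff)
  \<comment> \<open>The left side splits as
    \<open>3 * Q / 2 + Q * (1 - a\<^sup>2) / 2\<close>.\<close>
  then have "2 * Q * (1 - a\<^sup>2 / 4) \<le> 3 + r"
    using Qr by (simp add: algebra_simps)
  moreover have "Q * (1 - a\<^sup>2 / 4) \<ge> 0" using Q a2 by simp
  ultimately have "(2 * Q * (1 - a\<^sup>2 / 4))\<^sup>2 \<le> (3 + r)\<^sup>2"
    by (intro power_mono) auto
  also have "\<dots> = 9 + 3 * (2 * r) + r\<^sup>2" by (simp add: power2_eq_square algebra_simps)
  also have "\<dots> \<le> 9 + 3 * (2 - u\<^sup>2 - v\<^sup>2) + r\<^sup>2" using rs by simp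
  also have "\<dots> = (4 - u\<^sup>2) * (4 - v\<^sup>2)" unfolding r2 by (simp add: algebra_simps)
  finally show ?thesis .
qed

text \<open>Writing \<open>p\<close> as \<open>pCons c R\<close> makes \<open>c\<close> the value at
  0 and \<open>poly R l\<close> the divided difference at \<open>l, 0\<close>, also for
  \<open>l = 0\<close>. The condition \<open>ne\<close> keeps the ellipse from shrinking to a
  point.\<close>

lemma crouzeix_two_by_two:
  fixes R :: "complex poly" and c l :: complex and b :: real
  defines "p \<equiv> pCons c R"
  assumes b: "b \<ge> 0" and ne: "l \<noteq> 0 \<or> b \<noteq> 0"
    and bound: "\<And>X Y. X\<^sup>2 + (cmod Y)\<^sup>2 = 1 \<Longrightarrow>
        cmod (poly p ((l * (1 + of_real X) + of_real b * Y) / 2)) < 1"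
  shows "4 * (b * cmod (poly R l))\<^sup>2 \<le> (4 - (cmod (poly p l))\<^sup>2) * (4 - (cmod c)\<^sup>2)"
proof -
  define s where "s = (b + sqrt ((cmod l)\<^sup>2 + b\<^sup>2)) / 2"
  define a where "a = cmod l / s"
  define t where "t = a\<^sup>2 / 4"
  define q where "q = poly R l"
  define Q where "Q = cmod q * s"
  have pl: "poly p l = c + l * q" by (simp add: p_def q_def)
  have w1: "cmod (poly p l) < 1" using bound[of 1 0] by simp
  have w2: "cmod c < 1" using bound[of "-1" 0] by (simp add: p_def)
  have "(cmod l)\<^sup>2 + b\<^sup>2 > 0" using ne by (auto simp: add_pos_nonneg add_nonneg_pos)
  then have s: "s > 0" using b by (simp add: s_def add_nonneg_pos)
  have la: "cmod l = s * a" using s by (simp add: a_def)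
  have a0: "a \<ge> 0" using s by (simp add: a_def)
  \<comment> \<open>Solving for \<open>b\<close> removes the root: in units of \<open>s / 2\<close>
    the semi-axes are \<open>1 - t\<close> and \<open>1 + t\<close>.\<close>
  have "2 * s - b = sqrt ((cmod l)\<^sup>2 + b\<^sup>2)"
    by (simp add: s_def field_simps)
  then have "(2 * s - b)\<^sup>2 = (s * a)\<^sup>2 + b\<^sup>2"
    by (simp flip: la)
  then have "s * b = s * (s * (1 - t))"
    by (simp add: t_def power2_eq_square algebra_simps)
  then have bs: "b = s * (1 - t)" using s by simp
  have bq: "4 * (b * cmod q)\<^sup>2 = (2 * Q * (1 - a\<^sup>2 / 4))\<^sup>2"
    by (simp add: bs Q_def t_def power2_eq_square algebra_simps)
  have "poly p l - c = l * q" by (simp add: pl)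
  then have d: "Q * a = cmod (poly p l - c)" by (simp add: norm_mult la Q_def)
  have u1: "(cmod (poly p l))\<^sup>2 \<le> 1" and u2: "(cmod c)\<^sup>2 \<le> 1"
    using w1 w2 by (auto simp: power_le_one)
  have Q0: "Q \<ge> 0" using s by (simp add: Q_def)
  have t1: "t \<le> 1" using bs b s by (simp add: zero_le_mult_iff)
  show ?thesis
  proof (cases "a < 1")
    case False
    \<comment> \<open>From \<open>Q \<le> Q * a \<le> Q * a\<^sup>2\<close> the quantity to bound is
      at most \<open>3 / 2 * (Q * a)\<close>, while both factors on the right are at least
      3.\<close>
    have "Q * a \<le> 2" unfolding d using norm_triangle_ineq4[of "poly p l" c] w1 w2 by simp
    moreover have "Q * 1 \<le> Q * a" using False Q0 by (intro mult_left_mono) auto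
    moreover have "1 * (Q * a) \<le> a * (Q * a)" using False Q0 a0 by (intro mult_right_mono) auto
    ultimately have "2 * Q * (1 - a\<^sup>2 / 4) \<le> 3"
      by (simp add: algebra_simps power2_eq_square)
    moreover have "0 \<le> 2 * Q * (1 - a\<^sup>2 / 4)" using Q0 t1 by (simp add: t_def)
    ultimately have "(2 * Q * (1 - a\<^sup>2 / 4))\<^sup>2 \<le> 3\<^sup>2" by (intro power_mono)
    also have "(3::real)\<^sup>2 = 3 * 3" by simp
    also have "\<dots> \<le> (4 - (cmod (poly p l))\<^sup>2) * (4 - (cmod c)\<^sup>2)"
      using u1 u2 by (intro mult_mono) auto
    finally show ?thesis by (simp add: bq flip: q_def)
  next
    case True
    have t: "0 \<le> t" "4 * t < 1" using True a0 by (auto simp: t_def power_less_one_iff)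
    obtain e where e: "cmod e = 1" "l = e * of_real (s * a)"
    proof (cases "l = 0")
      case True
      then show ?thesis using that[of 1] la by simp
    next
      case False
      then show ?thesis
        using that[of "sgn l"] unfolding la[symmetric] by (simp add: norm_sgn) (simp add: sgn_eq)
    qed
    \<comment> \<open>As \<open>a\<^sup>2 = 4 * t\<close>, this constant makes \<open>\<phi>\<close>
      vanish at \<open>-a\<close>; \<open>\<psi>\<close> below is the cofactor of
      \<open>z + a\<close>.\<close>
    define \<mu> where "\<mu> = 1 - 4 * t\<^sup>2"
    have \<mu>: "\<mu> = 1 - a\<^sup>2 * t" by (simp add: \<mu>_def t_def power2_eq_square)
    define \<phi> where "\<phi> z = e * of_real s / 2 * (of_real a + of_real \<mu> * z / (1 - of_real t * z\<^sup>2))" for z :: complex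
    define \<psi> where "\<psi> z = e * of_real s / 2 * ((1 - of_real (a * t) * z) / (1 - of_real t * z\<^sup>2))" for z :: complex
    have nz: "1 - of_real t * z\<^sup>2 \<noteq> 0" if "norm z \<le> 1" for z :: complex
    proof
      assume "1 - of_real t * z\<^sup>2 = 0"
      then have "1 = cmod (of_real t * z\<^sup>2)" by (metis eq_iff_diff_eq_0 norm_one)
      also have "\<dots> \<le> t * 1" using t that by (simp add: norm_mult norm_power mult_left_le power_le_one)
      finally show False using t by simp
    qed
    have \<phi>\<psi>: "\<phi> z = (z + of_real a) * \<psi> z" if "norm z \<le> 1" for z
    proof -
      have "of_real a + of_real \<mu> * z / (1 - of_real t * z\<^sup>2)
          = (z + of_real a) * ((1 - of_real (a * t) * z) / (1 - of_real t * z\<^sup>2))"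
        using nz[OF that] by (simp add: \<mu> field_simps power2_eq_square)
      then show ?thesis by (simp add: \<phi>_def \<psi>_def)
    qed
    have \<psi>a: "\<psi> (of_real a) = e * of_real s / 2"
      using nz[of "of_real a"] True a0 by (simp add: \<psi>_def power2_eq_square algebra_simps)
    have \<phi>a: "\<phi> (of_real a) = l"
      using \<phi>\<psi>[of "of_real a"] True a0 by (simp add: \<psi>a e)
    define h where "h z = poly p (\<phi> z)" for z
    define k where "k z = poly R (\<phi> z) * \<psi> z" for z
    have ha: "h (of_real a) = poly p l" by (simp add: h_def \<phi>a)
    have "cmod (k (of_real a)) * cmod (1 - cnj (of_real (- a)) * of_real a) \<le> cmod (1 - cnj c * h (of_real a))"
    proof (rule schwarz_pick_divided_difference)
      show "h holomorphic_on ball 0 1" "k holomorphic_on ball 0 1"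
        unfolding h_def k_def \<phi>_def \<psi>_def using nz by (auto intro!: holomorphic_intros)
      show "continuous_on (cball 0 1) h" "continuous_on (cball 0 1) k"
        unfolding h_def k_def \<phi>_def \<psi>_def using nz by (auto intro!: continuous_intros)
      show "h z = c + (z - of_real (- a)) * k z" if "norm z \<le> 1" for z
        using \<phi>\<psi>[OF that] by (simp add: h_def k_def p_def)
      show "cmod (h z) \<le> 1" if z: "norm z = 1" for z
      proof -
        \<comment> \<open>This matches the semi-axes of the two ellipse lemmas. The rotation
          \<open>e\<close> is later absorbed into \<open>Y\<close>, which leaves its modulus
          unchanged.\<close>
        have "a\<^sup>2 + (1 - t)\<^sup>2 = (1 + t)\<^sup>2" by (simp add: t_def power2_eq_square algebra_simps)
        then obtain X Y where XY: "X\<^sup>2 + (cmod Y)\<^sup>2 = 1"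
          "of_real \<mu> * z / (1 - of_real t * z\<^sup>2) = of_real (a * X) + of_real (1 - t) * Y"
          using ellipse_eq_projected_sphere[of "1 - t" "of_real \<mu> * z / (1 - of_real t * z\<^sup>2)" a]
            inverted_ellipse_in_ellipse[OF t z] t unfolding \<mu>_def by auto
        have "\<phi> z = (l * (1 + of_real X) + of_real b * (e * Y)) / 2"
          unfolding \<phi>_def XY(2) bs e(2) by (simp add: field_simps)
        moreover have "X\<^sup>2 + (cmod (e * Y))\<^sup>2 = 1" using XY e by (simp add: norm_mult)
        ultimately show ?thesis unfolding h_def by (simp only: bound less_imp_le)
      qed
    qed (use w2 True a0 in auto)
    moreover have "cmod (k (of_real a)) = Q / 2"
      unfolding k_def \<phi>a \<psi>a q_def[symmetric] using e(1) s by (simp add: norm_mult norm_divide Q_def)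
    moreover have "cmod (1 - cnj (of_real (- a)) * of_real a) = 1 + a\<^sup>2"
    proof -
      have "1 - cnj (of_real (- a)) * of_real a = (of_real (1 + a\<^sup>2) :: complex)"
        by (simp add: power2_eq_square)
      then show ?thesis by (simp only: norm_of_real) (simp add: add_nonneg_nonneg)
    qed
    ultimately have "Q / 2 * (1 + a\<^sup>2) \<le> cmod (1 - cnj c * poly p l)" by (simp add: ha)
    then have "(Q / 2 * (1 + a\<^sup>2))\<^sup>2 \<le> (cmod (1 - cnj c * poly p l))\<^sup>2"
      using Q0 by (intro power_mono) auto
    also have "\<dots> = (Q * a)\<^sup>2 + (1 - (cmod c)\<^sup>2) * (1 - (cmod (poly p l))\<^sup>2)"
      unfolding norm_one_minus_cnj_mult_sq d ..
    \<comment> \<open>Moving \<open>(Q * a)\<^sup>2\<close> to the left turns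
      \<open>(1 + a\<^sup>2)\<^sup>2 / 4 - a\<^sup>2\<close> into
      \<open>(1 - a\<^sup>2)\<^sup>2 / 4\<close>.\<close>
    finally have pick: "(Q * (1 - a\<^sup>2) / 2)\<^sup>2 \<le> (1 - (cmod (poly p l))\<^sup>2) * (1 - (cmod c)\<^sup>2)"
      by (simp add: power2_eq_square field_simps)
    \<comment> \<open>The parallelogram law supplies the remaining hypothesis \<open>d\<close> of
      the scalar estimate.\<close>
    have "(cmod (poly p l - c))\<^sup>2 + (cmod (poly p l + c))\<^sup>2 = 2 * ((cmod (poly p l))\<^sup>2 + (cmod c)\<^sup>2)"
      unfolding cmod_power2 by (simp add: power2_eq_square algebra_simps)
    then have "(Q * a)\<^sup>2 \<le> 2 * ((cmod (poly p l))\<^sup>2 + (cmod c)\<^sup>2)"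
      unfolding d using zero_le_power2[of "cmod (poly p l + c)"] by linarith
    from crouzeix_scalar_estimate[OF a0 True Q0 u1 u2 this pick]
    show ?thesis unfolding q_def[symmetric] bq .
  qed
qed

section \<open>Hermitian inner product and orthogonal components\<close>

lemma cinner_add_left: "cinner (x + y) z = cinner x z + cinner y z"
  by (simp add: cinner_def sum.distrib algebra_simps)

lemma cinner_add_right: "cinner z (x + y) = cinner z x + cinner z y"
  by (simp add: cinner_def sum.distrib algebra_simps)

lemma cinner_diff_left: "cinner (x - y) z = cinner x z - cinner y z"
  by (simp add: cinner_def sum_subtractf algebra_simps)

lemma cinner_scale_left: "cinner (c *s x) z = c * cinner x z"
  by (simp add: cinner_def sum_distrib_left mult.assoc)

lemma cinner_scale_right: "cinner z (c *s x) = cnj c * cinner z x"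
  by (simp add: cinner_def sum_distrib_left algebra_simps)

lemma cinner_commute: "cinner y x = cnj (cinner x y)"
  by (simp add: cinner_def mult.commute)

lemma cinner_eq_0_commute: "cinner y x = 0 \<longleftrightarrow> cinner x y = 0"
  by (subst cinner_commute) simp

lemmas cinner_simps = cinner_add_left cinner_add_right cinner_diff_left
  cinner_scale_left cinner_scale_right

lemma norm_cscale: "norm (c *s x) = cmod c * norm x" for x :: "complex ^ 'n"
  by (simp add: norm_vec_def norm_mult L2_set_right_distrib)

lemma norm_sq_orthogonal_decomposition:
  fixes e1 e2 z :: "complex ^ 'n"
  assumes "cinner e1 e1 = 1" "cinner e2 e2 = 1" "cinner e2 e1 = 0" "cinner z e1 = 0" "cinner z e2 = 0"
  shows "(norm (\<alpha> *s e1 + \<beta> *s e2 + z))\<^sup>2 = (cmod \<alpha>)\<^sup>2 + (cmod \<beta>)\<^sup>2 + (norm z)\<^sup>2"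
proof -
  have "cinner e1 e2 = 0" "cinner e1 z = 0" "cinner e2 z = 0"
    using assms by (simp_all add: cinner_eq_0_commute[of e1] cinner_eq_0_commute[of e2 z])
  then have "cinner (\<alpha> *s e1 + \<beta> *s e2 + z) (\<alpha> *s e1 + \<beta> *s e2 + z)
      = \<alpha> * cnj \<alpha> + \<beta> * cnj \<beta> + cinner z z"
    using assms by (simp add: cinner_simps)
  then have "of_real ((norm (\<alpha> *s e1 + \<beta> *s e2 + z))\<^sup>2)
      = (of_real ((cmod \<alpha>)\<^sup>2 + (cmod \<beta>)\<^sup>2 + (norm z)\<^sup>2) :: complex)"
    unfolding of_real_add cinner_self complex_norm_square .
  then show ?thesis unfolding of_real_eq_iff .
qed

lemma exists_unit_multiple:
  fixes y :: "complex ^ 'n"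
  assumes "y \<noteq> 0"
  obtains e where "cinner e e = 1" "y = of_real (norm y) *s e"
proof
  show "cinner (of_real (1 / norm y) *s y) (of_real (1 / norm y) *s y) = 1"
    using assms by (simp add: cinner_self norm_cscale norm_divide)
  show "y = of_real (norm y) *s (of_real (1 / norm y) *s y)"
    using assms by (simp add: vector_smult_assoc)
qed

text \<open>One Gram-Schmidt step; the phase of the remainder goes into \<open>e2\<close>, so
  \<open>b\<close> is real and nonnegative.\<close>

lemma exists_unit_orthogonal_component:
  fixes y e :: "complex ^ 'n"
  assumes e: "cinner e e = 1" and y: "y \<noteq> cinner y e *s e"
  obtains e2 b where "cinner e2 e2 = 1" "cinner e2 e = 0" "b \<ge> 0"
    "y = cinner y e *s e + of_real b *s e2"
proof -
  define w where "w = y - cinner y e *s e"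
  have w: "w \<noteq> 0" using y by (simp add: w_def)
  obtain e2 where e2: "cinner e2 e2 = 1" "w = of_real (norm w) *s e2"
    using exists_unit_multiple[OF w] .
  have "cinner w e = 0" by (simp add: w_def cinner_simps e)
  then have "cinner e2 e = 0"
    using w by (subst (asm) e2(2)) (simp add: cinner_simps)
  moreover have "y = cinner y e *s e + of_real (norm w) *s e2"
    unfolding e2(2)[symmetric] by (simp add: w_def)
  ultimately show ?thesis using that[of e2 "norm w"] e2(1) by simp
qed

section \<open>Rank one matrices and their polynomials\<close>

text \<open>All rows are multiples of one row \<open>r\<close>. Its conjugate gives
  \<open>v\<close>, since \<open>cinner\<close> is conjugate linear on the right, and the length of
  the column factor \<open>u\<close> is moved into \<open>v\<close> to make \<open>e\<close> a unit
  vector.\<close>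

lemma rank_one_eq_outer_product:
  fixes A :: "complex ^ 'n ^ 'n"
  assumes "rank A = 1"
  obtains e v where "cinner e e = 1" "v \<noteq> 0" "\<And>x. A *v x = cinner x v *s e"
proof -
  obtain B where B: "B \<subseteq> rows A" "vec.independent B" "rows A \<subseteq> vec.span B" "card B = 1"
    using vec.basis_exists[of "rows A"] assms unfolding row_rank_def_gen by metis
  then obtain r where r: "B = {r}" by (meson card_1_singletonE)
  have r0: "r \<noteq> 0" using B(2) r by auto
  have "\<forall>i. \<exists>c. A $ i = c *s r"
  proof
    fix i
    have "A $ i \<in> vec.span {r}"
      using B(3) unfolding r rows_def row_def by auto
    then show "\<exists>c. A $ i = c *s r" by (auto simp: vec.span_singleton)
  qed
  then obtain w where w: "\<And>i. A $ i = w i *s r" by metis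
  define u where "u = (\<chi> i. w i)"
  define v where "v = (\<chi> j. cnj (r $ j))"
  have Ax: "A *v x = cinner x v *s u" for x
    by (simp add: vec_eq_iff matrix_vector_mult_def w cinner_def u_def v_def
        sum_distrib_left algebra_simps)
  have v0: "v \<noteq> 0" using r0 by (simp add: v_def vec_eq_iff)
  have u0: "u \<noteq> 0"
  proof
    assume "u = 0"
    then have "A $ i = 0" for i by (simp add: w u_def vec_eq_iff)
    then have "rows A \<subseteq> {0}" by (auto simp: rows_def row_def vec_eq_iff)
    then show False using B(1) r r0 by auto
  qed
  obtain e where e: "cinner e e = 1" "u = of_real (norm u) *s e"
    using exists_unit_multiple[OF u0] .
  show ?thesis
  proof
    show "cinner e e = 1" by (fact e)
    show "of_real (norm u) *s v \<noteq> 0" using u0 v0 by simp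
    show "A *v x = cinner x (of_real (norm u) *s v) *s e" for x
      unfolding Ax by (subst e(2)) (simp add: cinner_simps vector_smult_assoc mult.commute)
  qed
qed

lemma matrix_power_Suc_mult_vec:
  assumes "\<And>x. A *v (A *v x) = l *s (A *v x)"
  shows "matrix_power A (Suc k) *v x = l ^ k *s (A *v x)"
proof (induction k)
  case (Suc k)
  have "matrix_power A (Suc (Suc k)) *v x = A *v (matrix_power A (Suc k) *v x)"
    by (simp add: matrix_vector_mul_assoc)
  then show ?case
    unfolding Suc by (simp add: vec.scale assms vector_smult_assoc mult.commute)
qed simp

lemma sum_scaled_matrices_mult_vec:
  fixes B :: "nat \<Rightarrow> complex ^ 'n ^ 'n"
  shows "(\<Sum>k\<le>n. (\<chi> i j. f k * B k $ i $ j)) *v x = (\<Sum>k\<le>n. f k *s (B k *v x))"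
proof -
  have "(\<chi> i j. f k * B k $ i $ j) *v x = f k *s (B k *v x)" for k
    by (simp add: vec_eq_iff matrix_vector_mult_def sum_distrib_left mult.assoc)
  then show ?thesis
    by (induction n) (simp_all add: matrix_vector_mult_add_rdistrib)
qed

text \<open>If the square of \<open>A\<close> is \<open>l\<close> times \<open>A\<close>, positive
  powers of \<open>A\<close> form a geometric progression, and the polynomial collapses to
  \<open>c\<close> times the identity plus \<open>poly R l\<close> times \<open>A\<close>.\<close>

lemma poly_matrix_mult_vec:
  assumes "\<And>x. A *v (A *v x) = l *s (A *v x)"
  shows "poly_matrix (pCons c R) A *v x = c *s x + poly R l *s (A *v x)"
proof -
  let ?p = "pCons c R"
  have "poly_matrix ?p A *v x = (\<Sum>k\<le>degree ?p. coeff ?p k *s (matrix_power A k *v x))"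
    unfolding poly_matrix_def by (rule sum_scaled_matrices_mult_vec)
  \<comment> \<open>For \<open>R = 0\<close> the degree of \<open>?p\<close> is 0 instead of
    \<open>Suc (degree R)\<close>; the extra term is zero.\<close>
  also have "\<dots> = (\<Sum>k\<le>Suc (degree R). coeff ?p k *s (matrix_power A k *v x))"
    by (rule sum.mono_neutral_left) (auto simp: coeff_eq_0 degree_pCons_le)
  also have "\<dots> = c *s x + (\<Sum>k\<le>degree R. coeff R k *s (matrix_power A (Suc k) *v x))"
    by (subst sum.atMost_Suc_shift) simp
  also have "(\<Sum>k\<le>degree R. coeff R k *s (matrix_power A (Suc k) *v x)) = poly R l *s (A *v x)"
    unfolding matrix_power_Suc_mult_vec[OF assms]
    by (simp add: poly_altdef vec.scale_sum_left vector_smult_assoc)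
  finally show ?thesis .
qed

section \<open>Numerical range of the block\<close>

text \<open>The unit vector \<open>x *s e1 + y *s e2\<close> has Hopf coordinates
  \<open>X = 2 * (cmod x)\<^sup>2 - 1\<close> and \<open>Y = 2 * y * cnj x\<close>. They are
  inverted with real \<open>x > 0\<close>, except at the pole \<open>X = -1\<close>, where
  \<open>x = 0\<close>.\<close>

lemma numerical_range_contains_projected_sphere:
  fixes A :: "complex ^ 'n ^ 'n"
  assumes e: "cinner e1 e1 = 1" "cinner e2 e2 = 1" "cinner e2 e1 = 0"
    and A: "\<And>x. A *v x = (l * cinner x e1 + of_real b * cinner x e2) *s e1"
    and XY: "X\<^sup>2 + (cmod Y)\<^sup>2 = 1"
  shows "(l * (1 + of_real X) + of_real b * Y) / 2 \<in> numerical_range A"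
proof -
  have e12: "cinner e1 e2 = 0" using e(3) by (simp add: cinner_eq_0_commute[of e1])
  have *: "l * (x * cnj x) + of_real b * (y * cnj x) \<in> numerical_range A"
    if "(cmod x)\<^sup>2 + (cmod y)\<^sup>2 = 1" for x y
  proof -
    let ?x = "x *s e1 + y *s e2"
    have "cinner ?x ?x = of_real ((cmod x)\<^sup>2 + (cmod y)\<^sup>2)"
      unfolding of_real_add complex_norm_square using e e12 by (simp add: cinner_simps)
    moreover have "cinner (A *v ?x) ?x = l * (x * cnj x) + of_real b * (y * cnj x)"
      unfolding A using e e12 by (simp add: cinner_simps algebra_simps)
    ultimately show ?thesis using that unfolding numerical_range_def
      by (metis (mono_tags, lifting) mem_Collect_eq of_real_1)
  qed
  have X1: "X\<^sup>2 \<le> 1\<^sup>2" unfolding one_power2 using XY zero_le_power2[of "cmod Y"] by linarith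
  show ?thesis
  proof (cases "X = -1")
    case True
    then have "Y = 0" using XY by simp
    then show ?thesis using *[of 0 1] True by simp
  next
    case False
    then have X: "X > -1" using X1 abs_le_square_iff[of X 1] by simp
    define x where "x = sqrt ((1 + X) / 2)"
    have x: "x > 0" "x\<^sup>2 = (1 + X) / 2" using X by (auto simp: x_def)
    define y where "y = Y / of_real (2 * x)"
    have "(cmod y)\<^sup>2 = (1 - X\<^sup>2) / (4 * x\<^sup>2)"
      using XY x(1) by (simp add: y_def norm_divide power_divide power_mult_distrib norm_mult)
    also have "\<dots> = (1 - X) / 2" using X unfolding x(2) by (simp add: field_simps power2_eq_square)
    finally have "(cmod (of_real x))\<^sup>2 + (cmod y)\<^sup>2 = 1" by (simp add: x(2) field_simps)
    note xy = *[OF this]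
    have "(of_real x * cnj (of_real x) :: complex) = (1 + of_real X) / 2"
      using arg_cong[OF x(2), of complex_of_real] by (simp add: power2_eq_square)
    moreover have "y * cnj (of_real x) = Y / 2" using x(1) by (simp add: y_def)
    ultimately have "l * (1 + of_real X) / 2 + of_real b * (Y / 2) \<in> numerical_range A"
      using xy by (simp only: times_divide_eq_right)
    then show ?thesis by (simp add: add_divide_distrib)
  qed
qed

theorem proposition2p4:
  fixes A :: "complex ^ 'n ^ 'n" and p :: "complex poly"
  assumes "rank A = 1"
  shows "onorm ((*v) (poly_matrix p A)) \<le> 2 * (SUP z\<in>numerical_range A. cmod (poly p z))"
proof (rule dense_ge)
  \<comment> \<open>Any number above the right side gives a strict bound \<open>M > 0\<close> for
    \<open>p\<close> on the numerical range, so dividing by \<open>M\<close> is safe even when the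
    supremum is 0.\<close>
  fix M' assume M': "2 * (SUP z\<in>numerical_range A. cmod (poly p z)) < M'"
  define M where "M = M' / 2"
  have p_less: "cmod (poly p z) < M" if "z \<in> numerical_range A" for z
    using cSUP_upper[OF that bdd_above_poly_numerical_range[of p]] M' by (simp add: M_def)
  have M: "M > 0"
    using numerical_range_nonempty[of A] p_less by (meson ex_in_conv norm_ge_zero le_less_trans)
  obtain c R where p: "p = pCons c R" by (rule pCons_cases)
  obtain e v where e: "cinner e e = 1" and v: "v \<noteq> 0" and Av: "\<And>x. A *v x = cinner x v *s e"
    using rank_one_eq_outer_product[OF assms] by blast
  define l where "l = cinner e v"
  have AA: "A *v (A *v x) = l *s (A *v x)" for x
    by (simp add: Av cinner_simps l_def vector_smult_assoc mult.commute)
  note pA = poly_matrix_mult_vec[OF AA, where c = c and R = R, folded p]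
  define q where "q = poly R l"
  have pl: "poly p l = c + l * q" by (simp add: p q_def)
  have l: "l \<in> numerical_range A"
    unfolding numerical_range_def using e
    by (auto simp: Av cinner_simps l_def intro!: exI[of _ e])
  have "norm (poly_matrix p A *v x) \<le> M' * norm x" for x
  \<comment> \<open>In dimension one no second basis vector exists and \<open>A\<close> is the
    scalar \<open>l\<close>.\<close>
  proof (cases "\<forall>y. y = cinner y e *s e")
    case True
    have "A *v x = l *s x"
      by (subst (1 2) True[rule_format, of x]) (simp add: Av cinner_simps l_def vector_smult_assoc mult.commute e)
    then have "poly_matrix p A *v x = poly p l *s x"
      by (simp add: pA pl q_def vector_smult_assoc vec.scale_left_distrib mult.commute)
    then have "norm (poly_matrix p A *v x) = cmod (poly p l) * norm x" by (simp add: norm_cscale)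
    also have "\<dots> \<le> M' * norm x"
      using p_less[OF l] M by (intro mult_right_mono) (auto simp: M_def)
    finally show ?thesis .
  next
    case False
    obtain e2 b where e2: "cinner e2 e2 = 1" "cinner e2 e = 0" and b: "b \<ge> 0"
      and veq: "v = cnj l *s e + of_real b *s e2"
    \<comment> \<open>If \<open>v\<close> is parallel to \<open>e\<close>, any unit vector
      orthogonal to \<open>e\<close> serves, with \<open>b = 0\<close>.\<close>
    proof (cases "v = cinner v e *s e")
      case True
      from False obtain y where "y \<noteq> cinner y e *s e" by auto
      then obtain e2 where "cinner e2 e2 = 1" "cinner e2 e = 0"
        using exists_unit_orthogonal_component[OF e] by blast
      then show ?thesis using that[of e2 0] True by (simp add: l_def flip: cinner_commute)
    next
      case False
      then show ?thesis
        using exists_unit_orthogonal_component[OF e] that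
        by (metis l_def cinner_commute)
    qed
    have A: "A *v x = (l * cinner x e + of_real b * cinner x e2) *s e" for x
      unfolding Av by (subst veq) (simp add: cinner_simps)
    have bound: "cmod (poly p ((l * (1 + of_real X) + of_real b * Y) / 2)) < M"
      if "X\<^sup>2 + (cmod Y)\<^sup>2 = 1" for X Y
      using p_less[OF numerical_range_contains_projected_sphere[OF e e2 A that]] .
    have scaled: "poly (pCons (c / of_real M) (smult (1 / of_real M) R)) z = poly p z / of_real M" for z
      by (simp add: p add_divide_distrib)
    have "4 * (b * cmod (poly (smult (1 / of_real M) R) l))\<^sup>2 \<le>
        (4 - (cmod (poly (pCons (c / of_real M) (smult (1 / of_real M) R)) l))\<^sup>2) * (4 - (cmod (c / of_real M))\<^sup>2)"
    proof (rule crouzeix_two_by_two[OF b])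
      show "l \<noteq> 0 \<or> b \<noteq> 0" using v veq by auto
      show "cmod (poly (pCons (c / of_real M) (smult (1 / of_real M) R))
          ((l * (1 + of_real X) + of_real b * Y) / 2)) < 1" if "X\<^sup>2 + (cmod Y)\<^sup>2 = 1" for X Y
        unfolding scaled norm_divide using bound[OF that] M by simp
    qed
    then have det: "4 * (cmod (of_real b * q / of_real M))\<^sup>2 \<le>
        (4 - (cmod (poly p l / of_real M))\<^sup>2) * (4 - (cmod (c / of_real M))\<^sup>2)"
      unfolding scaled using b M by (simp add: norm_mult norm_divide q_def)
    have c: "cmod c < M" using bound[of "-1" 0] by (simp add: p)
    define x1 x2 where "x1 = cinner x e" and "x2 = cinner x e2"
    \<comment> \<open>\<open>A\<close> annihilates \<open>z\<close>, so the polynomial acts on it as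
      the scalar \<open>c\<close>, and \<open>cmod c < M\<close>.\<close>
    define z where "z = x - x1 *s e - x2 *s e2"
    have "cinner e e2 = 0" using e2(2) by (simp add: cinner_eq_0_commute[of e])
    then have z: "cinner z e = 0" "cinner z e2 = 0"
      by (simp_all add: z_def cinner_simps e e2 x1_def x2_def)
    have xz: "x = x1 *s e + x2 *s e2 + z" by (simp add: z_def)
    have "poly_matrix p A *v x = (poly p l * x1 + of_real b * q * x2) *s e + (c * x2) *s e2 + c *s z"
      unfolding pA A x1_def[symmetric] x2_def[symmetric] pl q_def[symmetric]
      by (subst xz) (simp add: vec_eq_iff algebra_simps)
    then have "(norm (poly_matrix p A *v x))\<^sup>2 =
        (cmod (poly p l * x1 + of_real b * q * x2))\<^sup>2 + (cmod (c * x2))\<^sup>2 + (cmod c * norm z)\<^sup>2"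
      using norm_sq_orthogonal_decomposition[OF e e2, of "c *s z"] z
      by (simp only: cinner_simps norm_cscale mult_zero_right)
    also have "(cmod (poly p l * x1 + of_real b * q * x2))\<^sup>2 + (cmod (c * x2))\<^sup>2
        = M\<^sup>2 * ((cmod (poly p l / of_real M * x1 + of_real b * q / of_real M * x2))\<^sup>2 + (cmod (c / of_real M * x2))\<^sup>2)"
      using M by (simp add: norm_divide power_divide distrib_left flip: add_divide_distrib)
        (simp add: add_divide_distrib)
    also have "\<dots> \<le> M\<^sup>2 * (4 * ((cmod x1)\<^sup>2 + (cmod x2)\<^sup>2))"
      using p_less[OF l] c M det
      by (intro mult_left_mono two_by_two_norm_bound) (auto simp: norm_divide)
    also have "(cmod c * norm z)\<^sup>2 \<le> (M * norm z)\<^sup>2"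
      using c by (intro power_mono mult_right_mono) auto
    also have "(M * norm z)\<^sup>2 \<le> M\<^sup>2 * (4 * (norm z)\<^sup>2)"
      by (simp add: power_mult_distrib)
    also have "M\<^sup>2 * (4 * ((cmod x1)\<^sup>2 + (cmod x2)\<^sup>2)) + M\<^sup>2 * (4 * (norm z)\<^sup>2)
        = (M' * norm x)\<^sup>2"
      unfolding power_mult_distrib
      by (subst xz, subst norm_sq_orthogonal_decomposition[OF e e2 z])
        (simp add: M_def power_divide algebra_simps)
    finally have "(norm (poly_matrix p A *v x))\<^sup>2 \<le> (M' * norm x)\<^sup>2" by simp
    then show ?thesis by (rule power2_le_imp_le) (use M in \<open>simp add: M_def\<close>)
  qed
  then show "onorm ((*v) (poly_matrix p A)) \<le> M'" by (rule onorm_le)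
qed

end
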